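(* Let $T$ be a truss. Suppose that $K \xrightarrow{i} P \xrightarrow{\pi} M$ and $K' \xrightarrow{i'} P' \xrightarrow{\pi'} M$ are short exact sequences of left $T$-modules; namely, there exist $m, m' \in M$ such that $\mathrm{Im}\, i = \ker_m \pi$ and $\mathrm{Im}\, i' = \ker_{m'} \pi'$. Suppose moreover that $\mathrm{Abs}(K')$ is not empty and that $P$ and $P'$ are projective $T$-modules. If $m = m'$, then there exists $e \in K$ yielding an isomorphism of $T$-modules $K^{(e)} \times P' \cong K' \times P$, where $K^{(e)}$ denotes the $e$-induced $T$-module structure on $K$.
   Context: A heap is a set $H$ with a ternary operation $[-,-,-]$ satisfying $[[a,b,c],d,e]=[a,b,[c,d,e]]$ and $[a,b,b]=a=[b,b,a]$; it is abelian if $[a,b,c]=[c,b,a]$. A truss is an abelian heap $T$ with an associative binary multiplication distributing over the heap operation on both sides: $w[x,y,z]=[wx,wy,wz]$ and $[x,y,z]w=[xw,yw,zw]$ (no identity is required). A left $T$-module is an abelian heap $M$ with an action $T\times M\to M$, $(t,m)\mapsto t\cdot m$, such that $t\cdot(t'\cdot m)=(tt')\cdot m$, $[t,t',t'']\cdot m=[t\cdot m,t'\cdot m,t''\cdot m]$ and $t\cdot[m,m',m'']=[t\cdot m,t\cdot m',t\cdot m'']$. Homomorphisms of $T$-modules ($T$-linear maps) preserve the heap operation and the action. The product of two $T$-modules has componentwise heap operation and action. For a $T$-linear map $g:N\to P$ and $p\in \mathrm{Im}\,g$, $\ker_p g=\{n\in N : g(n)=p\}$. A short exact sequence of $T$-modules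 $M\xrightarrow{f} N\xrightarrow{g} P$ (written with dotted $\star\to M$ on the left and $P\to\star$ on the right) consists of non-empty $T$-modules and $T$-linear maps $f,g$ such that $f$ is injective, $g$ is surjective and there exists $p\in\mathrm{Im}\,g$ with $\mathrm{Im}\,f=\ker_p g$ as sets. $\mathrm{Abs}(M)=\{m\in M : t\cdot m=m \text{ for all } t\in T\}$ is the set of absorbers of $M$. For $e\in M$, the $e$-induced module $M^{(e)}$ is the heap $M$ with the action $t\cdot_e m=[t\cdot m,t\cdot e,e]$. A $T$-module $P$ is projective if for every surjective $T$-linear map $\pi:M\to N$ and every $T$-linear map $f:P\to N$ there exists a $T$-linear map $\tilde f:P\to M$ with $\pi\circ\tilde f=f$. *)

theory Defs
  imports "HOL-Algebra.Congruence"
begin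


record 'a heap = "'a partial_object" +
  bracket :: "'a \<Rightarrow> 'a \<Rightarrow> 'a \<Rightarrow> 'a"

record 'a truss = "'a heap" +
  tmult :: "'a \<Rightarrow> 'a \<Rightarrow> 'a"

record ('t, 'm) truss_module = "'m heap" +
  act :: "'t \<Rightarrow> 'm \<Rightarrow> 'm"

text \<open>Carriers may be empty; non-emptiness is demanded where it is needed.\<close>

locale heap =
  fixes H (structure)
  assumes bracket_closed:
      "\<lbrakk>a \<in> carrier H; b \<in> carrier H; c \<in> carrier H\<rbrakk> \<Longrightarrow> bracket H a b c \<in> carrier H"
    and bracket_assoc:
      "\<lbrakk>a \<in> carrier H; b \<in> carrier H; c \<in> carrier H; d \<in> carrier H; e \<in> carrier H\<rbrakk> \<Longrightarrow>
        bracket H (bracket H a b c) d e = bracket H a b (bracket H c d e)"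
    and bracket_right: "\<lbrakk>a \<in> carrier H; b \<in> carrier H\<rbrakk> \<Longrightarrow> bracket H a b b = a"
    and bracket_left: "\<lbrakk>a \<in> carrier H; b \<in> carrier H\<rbrakk> \<Longrightarrow> bracket H b b a = a"

locale abelian_heap = heap +
  assumes bracket_commute:
      "\<lbrakk>a \<in> carrier H; b \<in> carrier H; c \<in> carrier H\<rbrakk> \<Longrightarrow> bracket H a b c = bracket H c b a"

locale truss = abelian_heap T for T (structure) +
  assumes tmult_closed: "\<lbrakk>x \<in> carrier T; y \<in> carrier T\<rbrakk> \<Longrightarrow> tmult T x y \<in> carrier T"
    and tmult_assoc:
      "\<lbrakk>x \<in> carrier T; y \<in> carrier T; z \<in> carrier T\<rbrakk> \<Longrightarrow>
        tmult T (tmult T x y) z = tmult T x (tmult T y z)"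
    and tmult_distrib_left:
      "\<lbrakk>w \<in> carrier T; x \<in> carrier T; y \<in> carrier T; z \<in> carrier T\<rbrakk> \<Longrightarrow>
        tmult T w (bracket T x y z) = bracket T (tmult T w x) (tmult T w y) (tmult T w z)"
    and tmult_distrib_right:
      "\<lbrakk>w \<in> carrier T; x \<in> carrier T; y \<in> carrier T; z \<in> carrier T\<rbrakk> \<Longrightarrow>
        tmult T (bracket T x y z) w = bracket T (tmult T x w) (tmult T y w) (tmult T z w)"

locale truss_module = T: truss T + M: abelian_heap M for T and M +
  assumes act_closed: "\<lbrakk>t \<in> carrier T; m \<in> carrier M\<rbrakk> \<Longrightarrow> act M t m \<in> carrier M"
    and act_assoc:
      "\<lbrakk>t \<in> carrier T; t' \<in> carrier T; m \<in> carrier M\<rbrakk> \<Longrightarrow>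
        act M t (act M t' m) = act M (tmult T t t') m"
    and act_bracket_truss:
      "\<lbrakk>t \<in> carrier T; t' \<in> carrier T; t'' \<in> carrier T; m \<in> carrier M\<rbrakk> \<Longrightarrow>
        act M (bracket T t t' t'') m = bracket M (act M t m) (act M t' m) (act M t'' m)"
    and act_bracket:
      "\<lbrakk>t \<in> carrier T; m \<in> carrier M; m' \<in> carrier M; m'' \<in> carrier M\<rbrakk> \<Longrightarrow>
        act M t (bracket M m m' m'') = bracket M (act M t m) (act M t m') (act M t m'')"

definition module_hom ::
  "('t, 'x) truss_scheme \<Rightarrow> ('t, 'm, 'y) truss_module_scheme \<Rightarrow>
    ('t, 'n, 'z) truss_module_scheme \<Rightarrow> ('m \<Rightarrow> 'n) set"
  where "module_hom T M N =
    {f. (\<forall>m \<in> carrier M. f m \<in> carrier N) \<and>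
        (\<forall>a \<in> carrier M. \<forall>b \<in> carrier M. \<forall>c \<in> carrier M.
           f (bracket M a b c) = bracket N (f a) (f b) (f c)) \<and>
        (\<forall>t \<in> carrier T. \<forall>m \<in> carrier M. f (act M t m) = act N t (f m))}"

text \<open>The inverse of a bijective homomorphism is automatically a homomorphism.\<close>

definition module_iso ::
  "('t, 'x) truss_scheme \<Rightarrow> ('t, 'm, 'y) truss_module_scheme \<Rightarrow>
    ('t, 'n, 'z) truss_module_scheme \<Rightarrow> bool"
  where "module_iso T M N \<longleftrightarrow> (\<exists>f \<in> module_hom T M N. bij_betw f (carrier M) (carrier N))"

definition prod_module ::
  "('t, 'm, 'y) truss_module_scheme \<Rightarrow> ('t, 'n, 'z) truss_module_scheme \<Rightarrow>
    ('t, 'm \<times> 'n) truss_module"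
  where "prod_module M N =
    \<lparr>carrier = carrier M \<times> carrier N,
     bracket = (\<lambda>a b c. (bracket M (fst a) (fst b) (fst c), bracket N (snd a) (snd b) (snd c))),
     act = (\<lambda>t a. (act M t (fst a), act N t (snd a)))\<rparr>"

definition absorbers ::
  "('t, 'x) truss_scheme \<Rightarrow> ('t, 'm, 'y) truss_module_scheme \<Rightarrow> 'm set"
  where "absorbers T M = {m \<in> carrier M. \<forall>t \<in> carrier T. act M t m = m}"

definition induced_module ::
  "('t, 'm) truss_module \<Rightarrow> 'm \<Rightarrow> ('t, 'm) truss_module"
  where "induced_module M e = M\<lparr>act := (\<lambda>t m. bracket M (act M t m) (act M t e) e)\<rparr>"

definition ker_at :: "('t, 'n, 'y) truss_module_scheme \<Rightarrow> ('n \<Rightarrow> 'p) \<Rightarrow> 'p \<Rightarrow> 'n set"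
  where "ker_at N g p = {n \<in> carrier N. g n = p}"

definition short_exact ::
  "('t, 'x) truss_scheme \<Rightarrow> ('t, 'm, 'y) truss_module_scheme \<Rightarrow> ('m \<Rightarrow> 'n) \<Rightarrow>
    ('t, 'n, 'z) truss_module_scheme \<Rightarrow> ('n \<Rightarrow> 'p) \<Rightarrow> ('t, 'p, 'w) truss_module_scheme \<Rightarrow> bool"
  where "short_exact T M f N g P \<longleftrightarrow>
    truss_module T M \<and> truss_module T N \<and> truss_module T P \<and>
    carrier M \<noteq> {} \<and> carrier N \<noteq> {} \<and> carrier P \<noteq> {} \<and>
    f \<in> module_hom T M N \<and> g \<in> module_hom T N P \<and>
    inj_on f (carrier M) \<and> g ` carrier N = carrier P \<and>
    (\<exists>p \<in> g ` carrier N. f ` carrier M = ker_at N g p)"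



text \<open>
  Projectivity of \<open>P\<close> quantifies over all modules, and HOL cannot quantify over their types
  inside a definition. The test modules below therefore have their carriers in one type that is
  large enough: the formal expressions built from elements of \<open>P\<close> by the module operations.
  Every lifting problem for \<open>P\<close> reduces to one of at most this size, by replacing the codomain by
  the image of \<open>P\<close> and the domain by the submodule generated by one preimage of each of its
  elements. Hence the lifting property holds for modules over arbitrary types; this is
  \<open>projective_lift\<close> below.
\<close>

datatype ('t, 'p) mexpr =
    Gen 'p
  | Act 't "('t, 'p) mexpr"
  | Br "('t, 'p) mexpr" "('t, 'p) mexpr" "('t, 'p) mexpr"

definition projective ::
  "('t, 'x) truss_scheme \<Rightarrow> ('t, 'p, 'y) truss_module_scheme \<Rightarrow> bool"
  where "projective T P \<longleftrightarrow>
    truss_module T P \<and>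
    (\<forall>(M :: ('t, ('t, 'p) mexpr) truss_module) (N :: ('t, ('t, 'p) mexpr) truss_module) \<pi> f.
       truss_module T M \<and> truss_module T N \<and>
       \<pi> \<in> module_hom T M N \<and> \<pi> ` carrier M = carrier N \<and> f \<in> module_hom T P N \<longrightarrow>
       (\<exists>g \<in> module_hom T P M. \<forall>p \<in> carrier P. \<pi> (g p) = f p))"

definition transport ::
  "('t, 'm, 'y) truss_module_scheme \<Rightarrow> 'm set \<Rightarrow> ('m \<Rightarrow> 'u) \<Rightarrow> ('u \<Rightarrow> 'm) \<Rightarrow> ('t, 'u) truss_module"
  where "transport M S c d =
    \<lparr>carrier = c ` S,
     bracket = (\<lambda>x y z. c (bracket M (d x) (d y) (d z))),
     act = (\<lambda>t x. c (act M t (d x)))\<rparr>"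

lemma truss_module_transport:
  assumes M: "truss_module T M" and S: "S \<subseteq> carrier M"
    and br: "\<And>x y z. \<lbrakk>x \<in> S; y \<in> S; z \<in> S\<rbrakk> \<Longrightarrow> bracket M x y z \<in> S"
    and ac: "\<And>t x. \<lbrakk>t \<in> carrier T; x \<in> S\<rbrakk> \<Longrightarrow> act M t x \<in> S"
    and dc: "\<And>x. x \<in> S \<Longrightarrow> d (c x) = x"
  shows "truss_module T (transport M S c d)"
proof -
  interpret truss_module T M by (rule M)
  have S': "\<And>x. x \<in> S \<Longrightarrow> x \<in> carrier M" using S by blast
  show ?thesis
    by unfold_locales
      (auto simp: transport_def dc br ac S' M.bracket_assoc M.bracket_right M.bracket_left
         act_assoc act_bracket_truss act_bracket T.bracket_closed T.tmult_closed
         intro!: arg_cong[where f = c] M.bracket_commute)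
qed

primrec mexpr_val ::
  "('t, 'm, 'y) truss_module_scheme \<Rightarrow> ('p \<Rightarrow> 'm) \<Rightarrow> ('t, 'p) mexpr \<Rightarrow> 'm" where
  "mexpr_val M s (Gen p) = s p"
| "mexpr_val M s (Act t x) = act M t (mexpr_val M s x)"
| "mexpr_val M s (Br x y z) = bracket M (mexpr_val M s x) (mexpr_val M s y) (mexpr_val M s z)"

inductive_set mexprs :: "'t set \<Rightarrow> 'p set \<Rightarrow> ('t, 'p) mexpr set" for A :: "'t set" and B :: "'p set"
  where
  "p \<in> B \<Longrightarrow> Gen p \<in> mexprs A B"
| "\<lbrakk>t \<in> A; x \<in> mexprs A B\<rbrakk> \<Longrightarrow> Act t x \<in> mexprs A B"
| "\<lbrakk>x \<in> mexprs A B; y \<in> mexprs A B; z \<in> mexprs A B\<rbrakk> \<Longrightarrow> Br x y z \<in> mexprs A B"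

theorem projective_lift:
  fixes M :: "('t, 'm, 'a) truss_module_scheme" and N :: "('t, 'n, 'b) truss_module_scheme"
    and P :: "('t, 'p, 'c) truss_module_scheme"
  assumes P: "projective T P" and M: "truss_module T M" and N: "truss_module T N"
    and \<pi>: "\<pi> \<in> module_hom T M N" and surj: "\<pi> ` carrier M = carrier N"
    and f: "f \<in> module_hom T P N"
  shows "\<exists>g \<in> module_hom T P M. \<forall>p \<in> carrier P. \<pi> (g p) = f p"
proof -
  interpret M: truss_module T M by (rule M)
  interpret N: truss_module T N by (rule N)
  interpret P: truss_module T P using P by (simp add: projective_def)
  have fP: "\<And>p. p \<in> carrier P \<Longrightarrow> f p \<in> carrier N"
    and fbr: "\<And>a b c. \<lbrakk>a \<in> carrier P; b \<in> carrier P; c \<in> carrier P\<rbrakk> \<Longrightarrow>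
      f (bracket P a b c) = bracket N (f a) (f b) (f c)"
    and fac: "\<And>t a. \<lbrakk>t \<in> carrier T; a \<in> carrier P\<rbrakk> \<Longrightarrow> f (act P t a) = act N t (f a)"
    using f by (auto simp: module_hom_def)
  have \<pi>br: "\<And>a b c. \<lbrakk>a \<in> carrier M; b \<in> carrier M; c \<in> carrier M\<rbrakk> \<Longrightarrow>
      \<pi> (bracket M a b c) = bracket N (\<pi> a) (\<pi> b) (\<pi> c)"
    and \<pi>ac: "\<And>t a. \<lbrakk>t \<in> carrier T; a \<in> carrier M\<rbrakk> \<Longrightarrow> \<pi> (act M t a) = act N t (\<pi> a)"
    using \<pi> by (auto simp: module_hom_def)
  define s where "s p = inv_into (carrier M) \<pi> (f p)" for p
  have s: "s p \<in> carrier M" "\<pi> (s p) = f p" if "p \<in> carrier P" for p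
    using fP[OF that] surj by (auto simp: s_def inv_into_into f_inv_into_f)
  define W where "W = mexprs (carrier T) (carrier P)"
  define v where "v = mexpr_val M s"
  define S where "S = v ` W"
  define c where "c = inv_into W v"
  have vc: "v (c x) = x" if "x \<in> S" for x
    using that by (simp add: S_def c_def f_inv_into_f)
  have SM: "S \<subseteq> carrier M"
  proof -
    have "v x \<in> carrier M" if "x \<in> W" for x
      using that unfolding W_def v_def
      by induction (auto simp: s M.act_closed M.M.bracket_closed)
    then show ?thesis by (auto simp: S_def)
  qed
  have Sbr: "bracket M x y z \<in> S" if xyz: "x \<in> S" "y \<in> S" "z \<in> S" for x y z
  proof -
    obtain x' y' z' where "x' \<in> W" "y' \<in> W" "z' \<in> W" "x = v x'" "y = v y'" "z = v z'"
      using xyz by (auto simp: S_def)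
    then have "bracket M x y z = v (Br x' y' z')" "Br x' y' z' \<in> W"
      by (auto simp: v_def W_def intro: mexprs.intros)
    then show ?thesis by (auto simp: S_def)
  qed
  have Sac: "act M t x \<in> S" if tx: "t \<in> carrier T" "x \<in> S" for t x
  proof -
    obtain x' where "x' \<in> W" "x = v x'"
      using tx by (auto simp: S_def)
    then have "act M t x = v (Act t x')" "Act t x' \<in> W"
      using tx by (auto simp: v_def W_def intro: mexprs.intros)
    then show ?thesis by (auto simp: S_def)
  qed
  have Ss: "s p \<in> S" if "p \<in> carrier P" for p
  proof -
    have "s p = v (Gen p)" "Gen p \<in> W"
      using that by (auto simp: v_def W_def intro: mexprs.intros)
    then show ?thesis by (auto simp: S_def)
  qed
  define R where "R = f ` carrier P"
  have fR: "f p \<in> R" if "p \<in> carrier P" for p using that by (simp add: R_def)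
  have RN: "R \<subseteq> carrier N" using fP by (auto simp: R_def)
  have Rbr: "bracket N x y z \<in> R" if "x \<in> R" "y \<in> R" "z \<in> R" for x y z
  proof -
    obtain a b c where abc: "a \<in> carrier P" "b \<in> carrier P" "c \<in> carrier P" "x = f a" "y = f b" "z = f c"
      using \<open>x \<in> R\<close> \<open>y \<in> R\<close> \<open>z \<in> R\<close> by (auto simp: R_def)
    then show ?thesis
      using fbr[of a b c] P.M.bracket_closed[of a b c] by (metis R_def imageI)
  qed
  have Rac: "act N t x \<in> R" if tx: "t \<in> carrier T" "x \<in> R" for t x
  proof -
    obtain a where "a \<in> carrier P" "x = f a"
      using tx by (auto simp: R_def)
    then show ?thesis
      using fac[of t a] P.act_closed[of t a] tx by (metis R_def imageI)
  qed
  have \<pi>S: "\<pi> x \<in> R" if "x \<in> S" for x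
  proof -
    have "\<pi> (v x) \<in> R \<and> v x \<in> carrier M" if "x \<in> W" for x
      using that unfolding W_def v_def
      by induction (auto simp: s \<pi>br \<pi>ac fR Rbr Rac M.act_closed M.M.bracket_closed)
    then show ?thesis using that by (auto simp: S_def)
  qed
  define k :: "'n \<Rightarrow> ('t, 'p) mexpr" where "k n = Gen (inv_into (carrier P) f n)" for n
  define w :: "('t, 'p) mexpr \<Rightarrow> 'n" where "w = mexpr_val N f"
  have wk: "w (k x) = x" if "x \<in> R" for x
    using that by (auto simp: R_def k_def w_def f_inv_into_f)
  let ?M = "transport M S c v" and ?N = "transport N R k w"
  have M': "truss_module T ?M" using M SM Sbr Sac vc by (rule truss_module_transport)
  have N': "truss_module T ?N" using N RN Rbr Rac wk by (rule truss_module_transport)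
  have SM': "x \<in> carrier M" if "x \<in> S" for x using that SM by blast
  have \<pi>': "(\<lambda>x. k (\<pi> (v x))) \<in> module_hom T ?M ?N"
    by (auto simp: module_hom_def transport_def vc wk \<pi>S Sbr Sac \<pi>br \<pi>ac SM')
  have surj': "(\<lambda>x. k (\<pi> (v x))) ` carrier ?M = carrier ?N"
  proof -
    have "k r \<in> (\<lambda>x. k (\<pi> (v x))) ` c ` S" if r: "r \<in> R" for r
    proof -
      obtain p where p: "p \<in> carrier P" "r = f p" using r by (auto simp: R_def)
      then have "k r = k (\<pi> (v (c (s p))))" by (simp add: vc Ss s)
      then show ?thesis using Ss[OF p(1)] by blast
    qed
    then show ?thesis by (auto simp: transport_def vc \<pi>S)
  qed
  have f': "(\<lambda>p. k (f p)) \<in> module_hom T P ?N"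
    by (auto simp: module_hom_def transport_def wk fR fbr fac)
  obtain g where g: "g \<in> module_hom T P ?M" "\<forall>p \<in> carrier P. k (\<pi> (v (g p))) = k (f p)"
    using P[unfolded projective_def, THEN conjunct2, rule_format, OF conjI[OF M' conjI[OF N'
      conjI[OF \<pi>' conjI[OF surj' f']]]]] by (elim bexE) simp
  have gc: "g p \<in> c ` S" if "p \<in> carrier P" for p
    using g(1) that by (auto simp: module_hom_def transport_def)
  have vg: "v (g p) \<in> S" if p: "p \<in> carrier P" for p
  proof -
    obtain x where "x \<in> S" "g p = c x" using gc[OF p] by (rule imageE)
    then show ?thesis by (simp add: vc)
  qed
  have gbr: "g (bracket P x y z) = c (bracket M (v (g x)) (v (g y)) (v (g z)))"
    if "x \<in> carrier P" "y \<in> carrier P" "z \<in> carrier P" for x y z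
    using g(1) that by (simp add: module_hom_def transport_def)
  have gac: "g (act P t x) = c (act M t (v (g x)))"
    if "t \<in> carrier T" "x \<in> carrier P" for t x
    using g(1) that by (simp add: module_hom_def transport_def)
  have "(\<lambda>p. v (g p)) \<in> module_hom T P M"
    unfolding module_hom_def by (simp add: gbr gac vg vc Sbr Sac SM')
  moreover have "\<pi> (v (g p)) = f p" if p: "p \<in> carrier P" for p
  proof -
    have "w (k (\<pi> (v (g p)))) = w (k (f p))" using g(2) p by simp
    then show ?thesis by (simp only: wk[OF \<pi>S[OF vg[OF p]]] wk[OF fR[OF p]])
  qed
  ultimately show ?thesis by (intro bexI[of _ "\<lambda>p. v (g p)"] ballI)
qed

end

theory Submission
  imports Defs
begin

text \<open>
  This is the module version of Schanuel's lemma. Both products are isomorphic to the pullback of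
  \<open>\<pi>\<close> and \<open>\<pi>'\<close>. Projectivity of \<open>P'\<close> gives a lift \<open>s\<close> of \<open>\<pi>'\<close> along \<open>\<pi>\<close>, and then for any
  \<open>e \<in> K\<close> the map \<open>(k, q) \<mapsto> ([i k, i e, s q], q)\<close> identifies \<open>K\<^sup>(\<^sup>e\<^sup>) \<times> P'\<close> with the pullback; the
  twist of the action compensates for \<open>i e\<close> not being fixed by \<open>T\<close>. Symmetrically, the
  pullback is \<open>K'\<^sup>(\<^sup>a\<^sup>) \<times> P\<close>, and for an absorber \<open>a\<close> of \<open>K'\<close> the twist is trivial. The heap
  structures match because \<open>m = m'\<close>, so that both kernels are taken at the same point.
\<close>

section \<open>Calculus of alternating sums in abelian heaps\<close>

context abelian_heap
begin

text \<open>Reading \<open>[a, b, c]\<close> as \<open>a - b + c\<close>, both sides are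
  \<open>a - b + c - d + e\<close>. As a rewrite rule, it moves a bracket out of the middle
  position.\<close>

lemma bracket_middle:
  assumes "a \<in> carrier H" "b \<in> carrier H" "c \<in> carrier H" "d \<in> carrier H" "e \<in> carrier H"
  shows "bracket H a (bracket H b c d) e = bracket H a d (bracket H c b e)"
proof -
  define x where "x = bracket H b c d"
  have x: "x \<in> carrier H" using assms by (simp add: x_def bracket_closed)
  \<comment> \<open>Solving \<open>x = [b, c, d]\<close> for \<open>d\<close> shows that the
    translations \<open>[c, b, _]\<close> and \<open>[d, x, _]\<close> agree; the leading
    \<open>a, d\<close> then cancels against \<open>d\<close>.\<close>
  have "bracket H c b x = d"
    using assms by (simp add: x_def bracket_left bracket_right flip: bracket_assoc)
  then have "bracket H c b e = bracket H d x e"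
    using assms x by (metis bracket_assoc bracket_left)
  then have "bracket H a d (bracket H c b e) = bracket H a x e"
    using assms x by (metis bracket_assoc bracket_right)
  then show ?thesis by (simp add: x_def)
qed

text \<open>In \<open>a - b + c - d + e\<close> the positive terms \<open>a\<close> and
  \<open>c\<close> may be exchanged; the next lemma does the same for the negative terms.\<close>

lemma bracket_swap_odd:
  assumes "a \<in> carrier H" "b \<in> carrier H" "c \<in> carrier H" "d \<in> carrier H" "e \<in> carrier H"
  shows "bracket H a b (bracket H c d e) = bracket H c b (bracket H a d e)"
  using assms by (metis bracket_assoc bracket_commute)

lemma bracket_swap_even:
  assumes "a \<in> carrier H" "b \<in> carrier H" "c \<in> carrier H" "d \<in> carrier H" "e \<in> carrier H"
  shows "bracket H a b (bracket H c d e) = bracket H a d (bracket H c b e)"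
  using assms by (metis bracket_middle bracket_commute)

text \<open>Both sides are the same alternating sum of nine terms. The rules nest brackets to the
  right, and the permutative ones then sort the positive and the negative terms separately, which
  gives a common normal form.\<close>

lemma bracket_interchange:
  assumes "a \<in> carrier H" "a' \<in> carrier H" "a'' \<in> carrier H"
    and "b \<in> carrier H" "b' \<in> carrier H" "b'' \<in> carrier H"
    and "c \<in> carrier H" "c' \<in> carrier H" "c'' \<in> carrier H"
  shows "bracket H (bracket H a a' a'') (bracket H b b' b'') (bracket H c c' c'') =
    bracket H (bracket H a b c) (bracket H a' b' c') (bracket H a'' b'' c'')"
  using assms
  by (simp add: bracket_closed bracket_assoc bracket_middle bracket_swap_odd bracket_swap_even
      bracket_commute)

end

section \<open>Homomorphisms, isomorphisms and products of modules\<close>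

lemma
  assumes "f \<in> module_hom T M N"
  shows module_hom_closed: "x \<in> carrier M \<Longrightarrow> f x \<in> carrier N"
    and module_hom_bracket: "\<lbrakk>x \<in> carrier M; y \<in> carrier M; z \<in> carrier M\<rbrakk> \<Longrightarrow>
      f (bracket M x y z) = bracket N (f x) (f y) (f z)"
    and module_hom_act: "\<lbrakk>t \<in> carrier T; x \<in> carrier M\<rbrakk> \<Longrightarrow> f (act M t x) = act N t (f x)"
  using assms by (auto simp: module_hom_def)

lemma module_homI:
  assumes "\<And>x. x \<in> carrier M \<Longrightarrow> f x \<in> carrier N"
    and "\<And>x y z. \<lbrakk>x \<in> carrier M; y \<in> carrier M; z \<in> carrier M\<rbrakk> \<Longrightarrow>
      f (bracket M x y z) = bracket N (f x) (f y) (f z)"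
    and "\<And>t x. \<lbrakk>t \<in> carrier T; x \<in> carrier M\<rbrakk> \<Longrightarrow> f (act M t x) = act N t (f x)"
  shows "f \<in> module_hom T M N"
  using assms by (simp add: module_hom_def)

lemma module_iso_trans:
  assumes "module_iso T L M" and "module_iso T M N"
  shows "module_iso T L N"
proof -
  obtain f g where f: "f \<in> module_hom T L M" "bij_betw f (carrier L) (carrier M)"
    and g: "g \<in> module_hom T M N" "bij_betw g (carrier M) (carrier N)"
    using assms by (auto simp: module_iso_def)
  have "g \<circ> f \<in> module_hom T L N"
    using f(1) g(1) by (simp add: module_hom_def)
  then show ?thesis
    using bij_betw_trans[OF f(2) g(2)] by (auto simp: module_iso_def)
qed

text \<open>Each operation of \<open>N\<close> is pulled back through \<open>f\<close>, and
  \<open>g\<close> cancels \<open>f\<close> because \<open>M\<close> is closed under its operations.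
  The module axioms are therefore asked of the source, which in the application is a product and not
  a pullback.\<close>

lemma module_iso_sym:
  assumes M: "truss_module T M" and iso: "module_iso T M N"
  shows "module_iso T N M"
proof -
  interpret truss_module T M by (rule M)
  obtain f where f: "f \<in> module_hom T M N" and bij: "bij_betw f (carrier M) (carrier N)"
    using iso by (auto simp: module_iso_def)
  define g where "g = inv_into (carrier M) f"
  have gN: "g y \<in> carrier M" and fg: "f (g y) = y" if "y \<in> carrier N" for y
    using that bij by (auto simp: g_def bij_betw_def inv_into_into f_inv_into_f)
  have gf: "g (f x) = x" if "x \<in> carrier M" for x
    using that bij by (simp add: g_def bij_betw_def)
  have "g \<in> module_hom T N M"
  proof (rule module_homI)
    fix x y z assume xyz: "x \<in> carrier N" "y \<in> carrier N" "z \<in> carrier N"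
    then have "g (bracket N x y z) = g (f (bracket M (g x) (g y) (g z)))"
      by (simp add: module_hom_bracket[OF f] gN fg)
    then show "g (bracket N x y z) = bracket M (g x) (g y) (g z)"
      using xyz by (simp add: gf gN M.bracket_closed)
  next
    fix t x assume tx: "t \<in> carrier T" "x \<in> carrier N"
    then have "g (act N t x) = g (f (act M t (g x)))"
      by (simp add: module_hom_act[OF f] gN fg)
    then show "g (act N t x) = act M t (g x)"
      using tx by (simp add: gf gN act_closed)
  qed (rule gN)
  moreover have "bij_betw g (carrier N) (carrier M)"
    unfolding g_def using bij by (rule bij_betw_inv_into)
  ultimately show ?thesis by (auto simp: module_iso_def)
qed

lemma truss_module_prod:
  assumes M: "truss_module T M" and N: "truss_module T N"
  shows "truss_module T (prod_module M N)"
proof -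
  interpret M: truss_module T M by (rule M)
  interpret N: truss_module T N by (rule N)
  show ?thesis
    by unfold_locales
      (auto simp: prod_module_def M.M.bracket_closed M.M.bracket_assoc M.M.bracket_right
        M.M.bracket_left M.act_closed M.act_assoc M.act_bracket_truss M.act_bracket
        N.M.bracket_closed N.M.bracket_assoc N.M.bracket_right
        N.M.bracket_left N.act_closed N.act_assoc N.act_bracket_truss N.act_bracket
        intro: M.M.bracket_commute N.M.bracket_commute)
qed

text \<open>The identity map works: for an absorber \<open>e\<close> the twisted action is
  \<open>[t m, e, e] = t m\<close>.\<close>

lemma module_iso_prod_induced_absorber:
  assumes M: "truss_module T M" and N: "truss_module T N" and e: "e \<in> absorbers T M"
  shows "module_iso T (prod_module M N) (prod_module (induced_module M e) N)"
proof -
  interpret M: truss_module T M by (rule M)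
  interpret N: truss_module T N by (rule N)
  have "id \<in> module_hom T (prod_module M N) (prod_module (induced_module M e) N)"
    using e by (auto simp: module_hom_def prod_module_def induced_module_def absorbers_def
        M.M.bracket_right M.act_closed)
  moreover have
    "bij_betw id (carrier (prod_module M N)) (carrier (prod_module (induced_module M e) N))"
    by (simp add: prod_module_def induced_module_def)
  ultimately show ?thesis unfolding module_iso_def by blast
qed

section \<open>Pullbacks and their decomposition as products\<close>

definition pullback_module ::
  "('t, 'm, 'y) truss_module_scheme \<Rightarrow> ('m \<Rightarrow> 'b) \<Rightarrow> ('t, 'n, 'z) truss_module_scheme \<Rightarrow>
    ('n \<Rightarrow> 'b) \<Rightarrow> ('t, 'm \<times> 'n) truss_module"
  where "pullback_module M f N g =
    (prod_module M N)\<lparr>carrier := {(x, y). x \<in> carrier M \<and> y \<in> carrier N \<and> f x = g y}\<rparr>"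

lemma module_iso_pullback_swap:
  "module_iso T (pullback_module M f N g) (pullback_module N g M f)"
proof -
  have "prod.swap \<in> module_hom T (pullback_module M f N g) (pullback_module N g M f)"
    by (auto simp: module_hom_def pullback_module_def prod_module_def)
  moreover have "bij_betw prod.swap (carrier (pullback_module M f N g))
      (carrier (pullback_module N g M f))"
    by (auto simp: bij_betw_def inj_on_def pullback_module_def image_iff)
  ultimately show ?thesis unfolding module_iso_def by blast
qed

text \<open>The lift \<open>s\<close> picks a point \<open>s q\<close> in the fibre of \<pi> over
  \<open>g q\<close>, and translation from \<open>i e\<close> to \<open>s q\<close> carries the
  fibre over \<open>m\<close>, a copy of \<open>K\<close>, onto that fibre. Indeed \<pi> sends
  \<open>[i k, i e, s q]\<close> to \<open>[m, m, g q] = g q\<close>.\<close>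

lemma module_iso_prod_pullback:
  assumes K: "truss_module T K" and P: "truss_module T P" and Q: "truss_module T Q"
    and M: "truss_module T M"
    and i: "i \<in> module_hom T K P" and inj: "inj_on i (carrier K)"
    and \<pi>: "\<pi> \<in> module_hom T P M" and ker: "i ` carrier K = ker_at P \<pi> m"
    and g: "g \<in> module_hom T Q M"
    and s: "s \<in> module_hom T Q P" and lift: "\<And>q. q \<in> carrier Q \<Longrightarrow> \<pi> (s q) = g q"
    and e: "e \<in> carrier K"
  shows "module_iso T (prod_module (induced_module K e) Q) (pullback_module P \<pi> Q g)"
proof -
  interpret K: truss_module T K by (rule K)
  interpret P: truss_module T P by (rule P)
  interpret Q: truss_module T Q by (rule Q)
  interpret M: truss_module T M by (rule M)
  note [simp] = module_hom_closed[OF i] module_hom_closed[OF s] module_hom_closed[OF g]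
    module_hom_bracket[OF i] module_hom_bracket[OF s] module_hom_bracket[OF \<pi>]
    module_hom_act[OF i] module_hom_act[OF s] lift e
    P.M.bracket_closed K.M.bracket_closed Q.M.bracket_closed
    P.act_closed K.act_closed Q.act_closed
  have \<pi>i: "\<pi> (i k) = m" if "k \<in> carrier K" for k
    using that ker by (auto simp: ker_at_def)
  have m: "m \<in> carrier M"
    using module_hom_closed[OF \<pi>, of "i e"] \<pi>i[OF e] by simp
  define \<phi> where "\<phi> = (\<lambda>(k, q). (bracket P (i k) (i e) (s q), q))"
  have "\<phi> \<in> module_hom T (prod_module (induced_module K e) Q) (pullback_module P \<pi> Q g)"
  proof (rule module_homI, goal_cases)
    case (1 x)
    then show ?case
      by (auto simp: \<phi>_def prod_module_def induced_module_def pullback_module_def \<pi>i m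
          M.M.bracket_left)
  next
    case (2 x y z)
    \<comment> \<open>Writing \<open>i e\<close> as \<open>[i e, i e, i e]\<close> gives a 3 by 3
      array, to which the interchange law applies.\<close>
    have "bracket P (bracket P a b c) (i e) (bracket P a' b' c') =
        bracket P (bracket P a (i e) a') (bracket P b (i e) b') (bracket P c (i e) c')"
      if "a \<in> carrier P" "b \<in> carrier P" "c \<in> carrier P"
        "a' \<in> carrier P" "b' \<in> carrier P" "c' \<in> carrier P" for a b c a' b' c'
      using that P.M.bracket_interchange[of a b c "i e" "i e" "i e" a' b' c']
      by (simp add: P.M.bracket_right)
    with 2 show ?case
      by (auto simp: \<phi>_def prod_module_def induced_module_def pullback_module_def)
  next
    \<comment> \<open>The twisted action yields
      \<open>[[t (i k), t (i e), i e], i e, t (s q)]\<close>; the adjacent copies of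
      \<open>i e\<close> cancel, leaving \<open>t\<close> applied to
      \<open>[i k, i e, s q]\<close>.\<close>
    case (3 t x)
    then show ?case
      by (auto simp: \<phi>_def prod_module_def induced_module_def pullback_module_def
          P.act_bracket P.M.bracket_assoc P.M.bracket_left)
  qed
  moreover have "bij_betw \<phi> (carrier (prod_module (induced_module K e) Q))
      (carrier (pullback_module P \<pi> Q g))"
  proof (rule bij_betw_imageI)
    show "inj_on \<phi> (carrier (prod_module (induced_module K e) Q))"
    proof (rule inj_onI)
      fix x y
      assume x: "x \<in> carrier (prod_module (induced_module K e) Q)"
        and y: "y \<in> carrier (prod_module (induced_module K e) Q)" and eq: "\<phi> x = \<phi> y"
      obtain k l q where xy: "x = (k, q)" "y = (l, q)"
        using eq by (cases x; cases y) (auto simp: \<phi>_def)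
      with x y have klq: "k \<in> carrier K" "l \<in> carrier K" "q \<in> carrier Q"
        by (auto simp: prod_module_def induced_module_def)
      \<comment> \<open>The translation \<open>[_, s q, i e]\<close> undoes
        \<open>[_, i e, s q]\<close> and so recovers \<open>i k\<close>.\<close>
      have "bracket P (bracket P (i k) (i e) (s q)) (s q) (i e) =
          bracket P (bracket P (i l) (i e) (s q)) (s q) (i e)"
        using eq by (simp add: xy \<phi>_def)
      then have "i k = i l"
        using klq by (simp add: P.M.bracket_assoc P.M.bracket_left P.M.bracket_right)
      then show "x = y"
        using inj klq by (simp add: xy inj_on_eq_iff)
    qed
    show "\<phi> ` carrier (prod_module (induced_module K e) Q) = carrier (pullback_module P \<pi> Q g)"
    proof
      show "\<phi> ` carrier (prod_module (induced_module K e) Q) \<subseteq> carrier (pullback_module P \<pi> Q g)"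
        using calculation by (auto simp: module_hom_def)
      show "carrier (pullback_module P \<pi> Q g) \<subseteq> \<phi> ` carrier (prod_module (induced_module K e) Q)"
      proof
        fix z assume "z \<in> carrier (pullback_module P \<pi> Q g)"
        then obtain p q where z: "z = (p, q)" "p \<in> carrier P" "q \<in> carrier Q" "\<pi> p = g q"
          by (auto simp: pullback_module_def)
        \<comment> \<open>The same inverse translation supplies the preimage: its value lies over
          \<open>[g q, g q, m] = m\<close>, hence comes from \<open>K\<close>.\<close>
        have "bracket P p (s q) (i e) \<in> ker_at P \<pi> m"
          using z by (simp add: ker_at_def \<pi>i m M.M.bracket_left)
        then obtain k where k: "k \<in> carrier K" "i k = bracket P p (s q) (i e)"
          using ker by (metis imageE)
        then have "\<phi> (k, q) = z"
          using z by (simp add: \<phi>_def P.M.bracket_assoc P.M.bracket_left P.M.bracket_right)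
        moreover have "(k, q) \<in> carrier (prod_module (induced_module K e) Q)"
          using k z by (simp add: prod_module_def induced_module_def)
        ultimately show "z \<in> \<phi> ` carrier (prod_module (induced_module K e) Q)" by blast
      qed
    qed
  qed
  ultimately show ?thesis unfolding module_iso_def by blast
qed

section \<open>Schanuel's lemma from the two decompositions of one pullback\<close>

theorem theorem3p4:
  fixes T :: "'t truss"
    and K :: "('t, 'k) truss_module" and P :: "('t, 'p) truss_module"
    and K' :: "('t, 'l) truss_module" and P' :: "('t, 'q) truss_module"
    and M :: "('t, 'm) truss_module"
    and i :: "'k \<Rightarrow> 'p" and \<pi> :: "'p \<Rightarrow> 'm" and i' :: "'l \<Rightarrow> 'q" and \<pi>' :: "'q \<Rightarrow> 'm"
    and m m' :: 'm
  assumes "truss T"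
    and "short_exact T K i P \<pi> M"
    and "short_exact T K' i' P' \<pi>' M"
    and "m \<in> carrier M" and "i ` carrier K = ker_at P \<pi> m"
    and "m' \<in> carrier M" and "i' ` carrier K' = ker_at P' \<pi>' m'"
    and "absorbers T K' \<noteq> {}"
    and "projective T P" and "projective T P'"
    and "m = m'"
  shows "\<exists>e \<in> carrier K. module_iso T (prod_module (induced_module K e) P') (prod_module K' P)"
proof -
  have K: "truss_module T K" and P: "truss_module T P" and M: "truss_module T M"
    and i: "i \<in> module_hom T K P" "inj_on i (carrier K)"
    and \<pi>: "\<pi> \<in> module_hom T P M" "\<pi> ` carrier P = carrier M"
    and "carrier K \<noteq> {}"
    using assms(2) by (auto simp: short_exact_def)
  have K': "truss_module T K'" and P': "truss_module T P'"
    and i': "i' \<in> module_hom T K' P'" "inj_on i' (carrier K')"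
    and \<pi>': "\<pi>' \<in> module_hom T P' M" "\<pi>' ` carrier P' = carrier M"
    using assms(3) by (auto simp: short_exact_def)
  have ker: "i ` carrier K = ker_at P \<pi> m" and ker': "i' ` carrier K' = ker_at P' \<pi>' m"
    using assms(5,7,11) by simp_all
  \<comment> \<open>Any point of \<open>K\<close> serves as \<open>e\<close>, whereas the base point
    \<open>a\<close> of \<open>K'\<close> must be an absorber.\<close>
  obtain e where e: "e \<in> carrier K" using \<open>carrier K \<noteq> {}\<close> by blast
  obtain a where a: "a \<in> absorbers T K'" using assms(8) by blast
  \<comment> \<open>Each projection onto \<open>M\<close> lifts along the other: its source is
    projective and the other projection is surjective.\<close>
  obtain s where s: "s \<in> module_hom T P' P" "\<And>q. q \<in> carrier P' \<Longrightarrow> \<pi> (s q) = \<pi>' q"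
    using projective_lift[OF assms(10) P M \<pi> \<pi>'(1)] by blast
  obtain s' where s': "s' \<in> module_hom T P P'" "\<And>p. p \<in> carrier P \<Longrightarrow> \<pi>' (s' p) = \<pi> p"
    using projective_lift[OF assms(9) P' M \<pi>' \<pi>(1)] by blast
  have "a \<in> carrier K'" using a by (simp add: absorbers_def)
  then have "module_iso T (prod_module (induced_module K' a) P) (pullback_module P' \<pi>' P \<pi>)"
    using module_iso_prod_pullback[OF K' P' P M i' \<pi>'(1) ker' \<pi>(1) s'] by blast
  then have "module_iso T (prod_module K' P) (pullback_module P' \<pi>' P \<pi>)"
    by (rule module_iso_trans[OF module_iso_prod_induced_absorber[OF K' P a]])
  then have "module_iso T (pullback_module P' \<pi>' P \<pi>) (prod_module K' P)"
    by (rule module_iso_sym[OF truss_module_prod[OF K' P]])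
  moreover have "module_iso T (prod_module (induced_module K e) P') (pullback_module P \<pi> P' \<pi>')"
    using module_iso_prod_pullback[OF K P P' M i \<pi>(1) ker \<pi>'(1) s e] by blast
  \<comment> \<open>The two pullbacks differ in the order of their factors, so the swap joins the
    two isomorphisms.\<close>
  ultimately have "module_iso T (prod_module (induced_module K e) P') (prod_module K' P)"
    by (meson module_iso_pullback_swap module_iso_trans)
  with e show ?thesis by blast
qed

end
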